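(* The map $\pi_m\circ g_m:M\to C_M$ is the inverse of $\overline{m}:C_M\to M$, and it is continuous.
   Context: On the square $[-1,1]^2$ the equivalence relation $\sim_{CM}$ is defined by: $(t,v)\sim_{CM}(t',v')$ if and only if either $v\in\{-1,1\}$ and $(t',v')\in\{(t,v),(-t,-v)\}$, or $v\notin\{-1,1\}$ and $(t',v')=(t,v)$. $C_M=[-1,1]^2/\!\sim_{CM}$ carries the quotient topology and $\pi_m:[-1,1]^2\to C_M$ is the canonical surjection. The map $m:[-1,1]^2\to\mathbb{R}^3$ is defined by $$m(t,v)=\Big(\big(1+\tfrac t2\cos\tfrac{v\pi}{2}\big)\cos(v\pi),\ \big(1+\tfrac t2\cos\tfrac{v\pi}{2}\big)\sin(v\pi),\ \tfrac t2\sin\tfrac{v\pi}{2}\Big),$$ and $M=m([-1,1]^2)\subset\mathbb{R}^3$ has the subspace topology. The map $m$ is compatible with $\sim_{CM}$, and $\overline{m}:C_M\to M$ is the unique continuous map with $m=\overline{m}\circ\pi_m$. For $(x,y)\neq(0,0)$, $\operatorname{atan2}(y,x)\in(-\pi,\pi]$ denotes the polar angle of the point $(x,y)$: $\operatorname{atan2}(0,x)=0$ if $x>0$ and $\pi$ if $x<0$; and for $y\ne0$, $\operatorname{atan2}(y,x)=\arctan(y/x)$ if $x>0$, $\varepsilon(y)\frac{\pi}{2}$ if $x=0$, $\arctan(y/x)+\varepsilon(y)\pi$ if $x<0$, where $\varepsilon(y)=\pm1$ is the sign of $y$. The map $g_m:M\to[-1,1]^2$ is defined by $g_m(x,y,z)=\big(\tau(x,y,z),\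 \frac1\pi\operatorname{atan2}(y,x)\big)$, where $\tau(x,y,z)=2(x-1)$ if $\operatorname{atan2}(y,x)=0$, and $\tau(x,y,z)=\dfrac{2z}{\sin\left(\frac{\operatorname{atan2}(y,x)}{2}\right)}$ otherwise. *)

theory Defs
  imports "HOL-Analysis.Analysis"
begin

definition quotient_topology :: "'a topology \<Rightarrow> ('a \<times> 'a) set \<Rightarrow> 'a set topology" where
  "quotient_topology X r =
     topology (\<lambda>U. U \<subseteq> topspace X // r \<and> openin X {x \<in> topspace X. r `` {x} \<in> U})"

lemma openin_quotient_topology:
  "openin (quotient_topology X r) U \<longleftrightarrow>
     U \<subseteq> topspace X // r \<and> openin X {x \<in> topspace X. r `` {x} \<in> U}"
proof -
  have "istopology (\<lambda>U. U \<subseteq> topspace X // r \<and> openin X {x \<in> topspace X. r `` {x} \<in> U})"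
    unfolding istopology_def
  proof (intro conjI allI impI)
    fix S T
    assume S: "S \<subseteq> topspace X // r \<and> openin X {x \<in> topspace X. r `` {x} \<in> S}"
      and T: "T \<subseteq> topspace X // r \<and> openin X {x \<in> topspace X. r `` {x} \<in> T}"
    show "S \<inter> T \<subseteq> topspace X // r" using S by blast
    have "{x \<in> topspace X. r `` {x} \<in> S \<inter> T} =
        {x \<in> topspace X. r `` {x} \<in> S} \<inter> {x \<in> topspace X. r `` {x} \<in> T}" by blast
    then show "openin X {x \<in> topspace X. r `` {x} \<in> S \<inter> T}"
      using S T by (simp add: openin_Int)
  next
    fix K
    assume K: "\<forall>U\<in>K. U \<subseteq> topspace X // r \<and> openin X {x \<in> topspace X. r `` {x} \<in> U}"
    show "\<Union>K \<subseteq> topspace X // r" using K by blast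
    have "{x \<in> topspace X. r `` {x} \<in> \<Union>K} = (\<Union>U\<in>K. {x \<in> topspace X. r `` {x} \<in> U})"
      by blast
    then show "openin X {x \<in> topspace X. r `` {x} \<in> \<Union>K}"
      using K by (simp only:) (rule openin_Union, blast)
  qed
  then show ?thesis by (simp add: quotient_topology_def)
qed

lemma topspace_quotient_topology: "topspace (quotient_topology X r) = topspace X // r"
proof -
  have "{x \<in> topspace X. r `` {x} \<in> topspace X // r} = topspace X"
    by (auto intro: quotientI)
  then have "openin (quotient_topology X r) (topspace X // r)"
    by (simp add: openin_quotient_topology)
  then show ?thesis
    by (meson openin_quotient_topology openin_subset openin_topspace subset_antisym)
qed

lemma quotient_map_quotient_topology:
  "quotient_map X (quotient_topology X r) (\<lambda>x. r `` {x})"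
  unfolding quotient_map_def
  by (auto simp: topspace_quotient_topology openin_quotient_topology quotient_def)

definition square :: "(real \<times> real) set" where
  "square = {-1..1} \<times> {-1..1}"

definition CM_rel :: "((real \<times> real) \<times> (real \<times> real)) set" where
  "CM_rel = {((t, v), (t', v')). (t, v) \<in> square \<and> (t', v') \<in> square \<and>
     (v \<in> {-1, 1} \<and> (t', v') \<in> {(t, v), (- t, - v)} \<or>
      v \<notin> {-1, 1} \<and> (t', v') = (t, v))}"

lemma equiv_CM_rel: "equiv square CM_rel"
  by (auto simp: equiv_def refl_on_def sym_def trans_def CM_rel_def)

definition CM :: "(real \<times> real) set set" where
  "CM = square // CM_rel"

definition CM_top :: "(real \<times> real) set topology" where
  "CM_top = quotient_topology (top_of_set square) CM_rel"

lemma topspace_CM_top [simp]: "topspace CM_top = CM"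
  by (simp add: CM_top_def CM_def topspace_quotient_topology)

definition pi_m :: "real \<times> real \<Rightarrow> (real \<times> real) set" where
  "pi_m p = CM_rel `` {p}"

lemma quotient_map_pi_m: "quotient_map (top_of_set square) CM_top pi_m"
  unfolding CM_top_def pi_m_def[abs_def] by (rule quotient_map_quotient_topology)

definition m :: "real \<times> real \<Rightarrow> real \<times> real \<times> real" where
  "m = (\<lambda>(t, v).
     ((1 + t / 2 * cos (v * pi / 2)) * cos (v * pi),
      (1 + t / 2 * cos (v * pi / 2)) * sin (v * pi),
      t / 2 * sin (v * pi / 2)))"

definition M :: "(real \<times> real \<times> real) set" where
  "M = m ` square"

lemma m_respects: "m respects CM_rel"
  by (auto simp: congruent_def CM_rel_def m_def)

lemma continuous_on_m: "continuous_on S m"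
  unfolding m_def case_prod_unfold by (intro continuous_intros) auto

text \<open>The map induced by \<^const>\<open>m\<close>: its value at a class is the common value of
  \<^const>\<open>m\<close> on that class. The lemmas below show that it is the unique
  continuous map on \<^const>\<open>CM\<close> through which \<^const>\<open>m\<close> factors.\<close>

definition mbar :: "(real \<times> real) set \<Rightarrow> real \<times> real \<times> real" where
  "mbar c = the_elem (m ` c)"

lemma mbar_pi_m:
  assumes "p \<in> square"
  shows "mbar (pi_m p) = m p"
proof -
  have "p \<in> pi_m p"
    using assms equiv_class_self[OF equiv_CM_rel] by (simp only: pi_m_def)
  moreover have "m q = m p" if "q \<in> pi_m p" for q
    using that m_respects by (auto simp: pi_m_def congruent_def)
  ultimately have "m ` pi_m p = {m p}" by blast
  then show ?thesis by (simp add: mbar_def)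
qed

lemma continuous_map_mbar: "continuous_map CM_top (top_of_set M) mbar"
proof (rule continuous_compose_quotient_map[OF quotient_map_pi_m])
  have "continuous_map (top_of_set square) (top_of_set M) m"
    by (auto simp: M_def continuous_on_m)
  then show "continuous_map (top_of_set square) (top_of_set M) (mbar \<circ> pi_m)"
    by (rule continuous_map_eq) (simp add: mbar_pi_m)
qed

lemma mbar_unique:
  assumes "\<And>p. p \<in> square \<Longrightarrow> f (pi_m p) = m p" and "c \<in> CM"
  shows "f c = mbar c"
  using assms by (auto simp: CM_def quotient_def mbar_pi_m simp flip: pi_m_def)

text \<open>The value \<open>0\<close> at the origin is a dummy; the origin is excluded from the domain.\<close>

definition atan2 :: "real \<Rightarrow> real \<Rightarrow> real" where
  "atan2 y x =
     (if y = 0 then (if x > 0 then 0 else if x < 0 then pi else 0)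
      else if x > 0 then arctan (y / x)
      else if x = 0 then sgn y * (pi / 2)
      else arctan (y / x) + sgn y * pi)"

lemma M_off_axis: "(x, y, z) \<in> M \<Longrightarrow> (x, y) \<noteq> (0, 0)"
proof
  assume "(x, y, z) \<in> M" and 0: "(x, y) = (0, 0)"
  then obtain t v where tv: "(t, v) \<in> square" "(x, y, z) = m (t, v)"
    by (auto simp: M_def)
  define r where "r = 1 + t / 2 * cos (v * pi / 2)"
  have "\<bar>t * cos (v * pi / 2)\<bar> \<le> 1 * 1"
    unfolding abs_mult using tv(1) by (intro mult_mono) (auto simp: square_def)
  then have "r > 0" by (simp add: r_def)
  moreover have "r * cos (v * pi) = 0" "r * sin (v * pi) = 0"
    using tv(2) 0 by (auto simp: m_def r_def)
  ultimately have "cos (v * pi) = 0" "sin (v * pi) = 0" by auto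
  then show False using sin_cos_squared_add[of "v * pi"] by simp
qed

definition tau :: "real \<times> real \<times> real \<Rightarrow> real" where
  "tau = (\<lambda>(x, y, z).
     if atan2 y x = 0 then 2 * (x - 1) else 2 * z / sin (atan2 y x / 2))"

definition g_m :: "real \<times> real \<times> real \<Rightarrow> real \<times> real" where
  "g_m = (\<lambda>(x, y, z). (tau (x, y, z), 1 / pi * atan2 y x))"

end

theory Submission
  imports Defs
begin

text \<open>
  On the part of the square with \<^term>\<open>-1 < v\<close> the map \<^const>\<open>g_m\<close> is a left inverse of \<^const>\<open>m\<close>:
  the planar part of \<^term>\<open>m (t, v)\<close> is a positive multiple of
  \<^term>\<open>(cos (v * pi), sin (v * pi))\<close>, so its polar angle recovers \<^term>\<open>v\<close>, and then
  \<^term>\<open>t\<close> is read off from the height, or from the radius when the angle vanishes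
  (\<open>g_m_m\<close>). On the remaining edge \<^term>\<open>v = -1\<close> the polar angle jumps to \<^const>\<open>pi\<close>, and
  \<^const>\<open>g_m\<close> returns the antipodal point \<^term>\<open>(-t, 1)\<close>, which is precisely the point
  identified with \<^term>\<open>(t, -1)\<close>. Hence \<open>pi_m \<circ> g_m \<circ> m = pi_m\<close> on the whole square
  (\<open>pi_m_g_m_m\<close>), and both inverse identities follow formally.

  The same equation yields continuity without any study of \<^const>\<open>atan2\<close> near its cut:
  \<^const>\<open>m\<close> is a continuous surjection from a compact space onto a Hausdorff space, hence a
  quotient map onto \<^const>\<open>M\<close>, so \<open>pi_m \<circ> g_m\<close> is continuous because its composite with
  \<^const>\<open>m\<close> is the continuous map \<^const>\<open>pi_m\<close>.
\<close>

text \<open>In the open right half-plane \<^const>\<open>arctan\<close> inverts \<^const>\<open>tan\<close>. In the open left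
  half-plane, off the horizontal axis, \<^term>\<open>arctan (tan \<theta>)\<close> is the representative of \<^term>\<open>\<theta>\<close> modulo \<^const>\<open>pi\<close>
  near \<open>0\<close>, namely \<^term>\<open>\<theta> - sgn \<theta> * pi\<close>; since \<^term>\<open>sin \<theta>\<close> has the sign of \<^term>\<open>\<theta>\<close>
  there, the correction term of \<^const>\<open>atan2\<close> restores \<^term>\<open>\<theta>\<close>.\<close>

lemma atan2_polar:
  assumes r: "r > 0" and \<theta>: "- pi < \<theta>" "\<theta> \<le> pi"
  shows "atan2 (r * sin \<theta>) (r * cos \<theta>) = \<theta>"
proof -
  have quot: "r * sin \<theta> / (r * cos \<theta>) = tan \<theta>"
    using r by (simp add: tan_def)
  consider "\<theta> = pi" | "\<theta> = pi / 2" | "\<theta> = - (pi / 2)" | "\<bar>\<theta>\<bar> < pi / 2"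
    | "pi / 2 < \<theta>" "\<theta> < pi" | "- pi < \<theta>" "\<theta> < - (pi / 2)"
    using \<theta> by linarith
  then show ?thesis
  proof cases
    case 1
    then show ?thesis using r by (simp add: atan2_def)
  next
    case 2
    show ?thesis unfolding 2 using r by (simp add: atan2_def sgn_mult)
  next
    case 3
    show ?thesis unfolding 3 using r by (simp add: atan2_def sgn_mult)
  next
    case 4
    then have "cos \<theta> > 0" by (intro cos_gt_zero_pi) auto
    moreover have "arctan (tan \<theta>) = \<theta>" using 4 by (intro arctan_tan) auto
    moreover have "\<theta> = 0" if "sin \<theta> = 0"
      using that \<open>arctan (tan \<theta>) = \<theta>\<close> by (simp add: tan_def)
    ultimately show ?thesis using r quot by (auto simp: atan2_def)
  next
    case 5
    then have "cos (\<theta> - pi) > 0" by (intro cos_gt_zero_pi) auto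
    then have c: "cos \<theta> < 0" by simp
    have s: "sin \<theta> > 0" using 5 pi_gt_zero by (intro sin_gt_zero) linarith+
    have "arctan (tan (\<theta> - pi)) = \<theta> - pi" using 5 by (intro arctan_tan) auto
    then have "arctan (tan \<theta>) = \<theta> - pi" by (simp add: tan_def)
    then show ?thesis using r c s quot
      by (simp add: atan2_def zero_less_mult_iff sgn_mult)
  next
    case 6
    then have "cos (\<theta> + pi) > 0" by (intro cos_gt_zero_pi) auto
    then have c: "cos \<theta> < 0" by simp
    have "sin (- \<theta>) > 0" using 6 pi_gt_zero by (intro sin_gt_zero) linarith+
    then have s: "sin \<theta> < 0" by simp
    have "arctan (tan (\<theta> + pi)) = \<theta> + pi" using 6 by (intro arctan_tan) auto
    then have "arctan (tan \<theta>) = \<theta> + pi" by (simp add: tan_def)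
    then show ?thesis using r c s quot
      by (simp add: atan2_def zero_less_mult_iff sgn_mult)
  qed
qed

text \<open>The bounds keep the radius \<^term>\<open>1 + t / 2 * cos (v * pi / 2)\<close> at least \<open>1/2\<close>, and
  the sine in the denominator of \<^const>\<open>tau\<close> vanishes only at angle \<open>0\<close>, where the other
  branch applies.\<close>

lemma g_m_m:
  assumes t: "\<bar>t\<bar> \<le> 1" and v: "-1 < v" "v \<le> 1"
  shows "g_m (m (t, v)) = (t, v)"
proof -
  define r where "r = 1 + t / 2 * cos (v * pi / 2)"
  have "\<bar>t * cos (v * pi / 2)\<bar> \<le> 1 * 1"
    unfolding abs_mult using t by (intro mult_mono) auto
  then have r: "r > 0" by (simp add: r_def)
  have "- pi < v * pi" using mult_strict_right_mono[OF v(1) pi_gt_zero] by simp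
  moreover have "v * pi \<le> pi" using mult_right_mono[OF v(2), of pi] by simp
  ultimately have angle: "atan2 (r * sin (v * pi)) (r * cos (v * pi)) = v * pi"
    by (intro atan2_polar r)
  have "tau (m (t, v)) = t"
  proof (cases "v = 0")
    case True
    then show ?thesis using angle by (simp add: tau_def m_def r_def)
  next
    case False
    have "sin (v * pi / 2) \<noteq> 0"
    proof
      assume 0: "sin (v * pi / 2) = 0"
      have "\<bar>v * pi\<bar> \<le> pi" using \<open>- pi < v * pi\<close> \<open>v * pi \<le> pi\<close> by linarith
      then have "v * pi / 2 = 0" using pi_gt_zero by (intro sin_eq_0_pi[OF _ _ 0]) linarith+
      then show False using False by simp
    qed
    then show ?thesis using angle False by (simp add: tau_def m_def r_def)
  qed
  then show ?thesis using angle by (simp add: g_m_def m_def r_def)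
qed

lemma pi_m_g_m_m:
  assumes "p \<in> square"
  shows "pi_m (g_m (m p)) = pi_m p"
proof -
  obtain t v where p: "p = (t, v)" "\<bar>t\<bar> \<le> 1" "-1 \<le> v" "v \<le> 1"
    using assms by (cases p) (auto simp: square_def)
  show ?thesis
  proof (cases "v = -1")
    case False
    then show ?thesis using p by (simp add: g_m_m)
  next
    case True
    have rel: "(p, (- t, 1)) \<in> CM_rel"
      using p True by (auto simp: CM_rel_def square_def)
    have "m p = m (- t, 1)" using rel by (rule congruentD[OF m_respects])
    moreover have "g_m (m (- t, 1)) = (- t, 1)" using p by (intro g_m_m) auto
    moreover have "pi_m p = pi_m (- t, 1)"
      unfolding pi_m_def using rel by (rule equiv_class_eq[OF equiv_CM_rel])
    ultimately show ?thesis by simp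
  qed
qed

lemma quotient_map_m: "quotient_map (top_of_set square) (top_of_set M) m"
proof (rule T1_Spaces.continuous_imp_quotient_map)
  show "continuous_map (top_of_set square) (top_of_set M) m"
    by (auto simp: M_def continuous_on_m)
  show "compact_space (top_of_set square)"
    by (simp add: compact_space_subtopology square_def compact_Times)
  show "Hausdorff_space (top_of_set M)"
    by (simp add: Hausdorff_space_subtopology)
  show "m ` topspace (top_of_set square) = topspace (top_of_set M)"
    by (simp add: M_def)
qed

theorem mainTheorem5:
  shows "(\<forall>c\<in>CM. (pi_m \<circ> g_m) (mbar c) = c)
    \<and> (\<forall>q\<in>M. mbar ((pi_m \<circ> g_m) q) = q)
    \<and> continuous_map (top_of_set M) CM_top (pi_m \<circ> g_m)"
proof (intro conjI ballI)
  fix c assume "c \<in> CM"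
  then obtain p where "p \<in> square" "c = pi_m p"
    by (auto simp: CM_def quotient_def pi_m_def)
  then show "(pi_m \<circ> g_m) (mbar c) = c"
    by (simp add: mbar_pi_m pi_m_g_m_m)
next
  fix q assume "q \<in> M"
  then obtain p where "p \<in> square" "q = m p"
    by (auto simp: M_def)
  then show "mbar ((pi_m \<circ> g_m) q) = q"
    by (simp add: mbar_pi_m pi_m_g_m_m)
next
  show "continuous_map (top_of_set M) CM_top (pi_m \<circ> g_m)"
  proof (rule continuous_compose_quotient_map[OF quotient_map_m])
    have "continuous_map (top_of_set square) CM_top pi_m"
      by (rule quotient_imp_continuous_map[OF quotient_map_pi_m])
    then show "continuous_map (top_of_set square) CM_top ((pi_m \<circ> g_m) \<circ> m)"
      by (rule continuous_map_eq) (simp add: pi_m_g_m_m)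
  qed
qed

end
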